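(* For every positive integer $m$, let $\mathrm{O2}(m)$ denote the number of partitions of $m$ in which no odd part is repeated, the largest part is even, and the largest part appears at least twice; and let $\mathrm{pod}_{>2}(m)$ denote the number of partitions of $m$ in which no odd part is repeated and every part is strictly greater than $2$. Then for all integers $n>4$, \[ \mathrm{O2}(n)+\mathrm{O2}(n-3)=\mathrm{pod}_{>2}(n). \]
   Context: A partition of $m$ is a finite non-increasing sequence of positive integers $\lambda_1\ge \lambda_2\ge\cdots\ge\lambda_k$ with sum $m$; its parts are the $\lambda_i$ and its largest part is $\lambda_1$. "No odd part is repeated" means every odd integer occurs at most once among the parts (even parts may repeat). *)

theory Defs
  imports Main
begin

definition is_partition :: "nat \<Rightarrow> nat list \<Rightarrow> bool" where
  "is_partition m p \<longleftrightarrow> sorted_wrt (\<ge>) p \<and> (\<forall>k\<in>set p. 0 < k) \<and> sum_list p = m"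

definition no_odd_repeated :: "nat list \<Rightarrow> bool" where
  "no_odd_repeated p \<longleftrightarrow> (\<forall>k. odd k \<longrightarrow> count_list p k \<le> 1)"

lemma finite_partitions: "finite {p. is_partition m p}"
proof (rule finite_subset)
  have "length p \<le> sum_list p" if "\<forall>k\<in>set p. 0 < k" for p :: "nat list"
    using that by (induction p) auto
  then show "{p. is_partition m p} \<subseteq> {p. set p \<subseteq> {..m} \<and> length p \<le> m}"
    by (auto simp: is_partition_def member_le_sum_list)
qed (rule finite_lists_length_le, simp)

(* The largest part of a non-increasing list is its first entry. Only the empty
   partition, which occurs just for m = 0, has no largest part. *)
definition O2 :: "nat \<Rightarrow> nat" where
  "O2 m = card {p. is_partition m p \<and> no_odd_repeated p \<and>
     p \<noteq> [] \<and> even (hd p) \<and> 2 \<le> count_list p (hd p)}"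

definition pod_gt2 :: "nat \<Rightarrow> nat" where
  "pod_gt2 m = card {p. is_partition m p \<and> no_odd_repeated p \<and> (\<forall>k\<in>set p. 2 < k)}"

end

(* Call a partition pod if no odd part is repeated, and let E(m) count the pod partitions of m
   that are empty or have even largest part. Adding 1 to the largest part (and sending the empty
   partition to (1)) shows that E(m) + E(m - 1) counts all pod partitions of m. Splitting off the
   part 1 shows the same for the number of pod partitions with all parts greater than 1, so by
   induction E(m) is that number, and splitting off one part 2 gives
   E(m) - E(m - 2) = pod_{>2}(m).
   On the other hand, adding 2 to the largest part embeds the partitions counted by E(m - 2) into
   those counted by E(m). What is missed has either a repeated largest part, or the two largest
   parts 2k, 2k - 1; for m > 3, replacing the latter by 2k - 2, 2k - 2 gives a bijection with the
   partitions counted by O2(m - 3). *)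

theory Submission
  imports Defs
begin

section \<open>Pod partitions as lists sorted by one relation\<close>

text \<open>Merging the order and the ban on repeated odd parts into one pairwise relation lets the
  rules for \<open>sorted_wrt\<close> treat both at once.\<close>

definition pod_rel :: "nat \<Rightarrow> nat \<Rightarrow> bool" where
  "pod_rel a b \<longleftrightarrow> b \<le> a \<and> (odd a \<longrightarrow> b \<noteq> a)"

lemma sorted_wrt_pod_rel:
  "sorted_wrt pod_rel p \<longleftrightarrow> sorted_wrt (\<ge>) p \<and> no_odd_repeated p"
proof (induction p)
  case (Cons x p)
  have "no_odd_repeated (x # p) \<longleftrightarrow> no_odd_repeated p \<and> (odd x \<longrightarrow> x \<notin> set p)"
  proof
    assume rep: "no_odd_repeated (x # p)"
    have "count_list p k \<le> 1" if "odd k" for k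
      using rep that unfolding no_odd_repeated_def by (cases "x = k") force+
    moreover have "x \<notin> set p" if "odd x"
      using rep that by (auto simp: no_odd_repeated_def simp flip: count_list_0_iff)
    ultimately show "no_odd_repeated p \<and> (odd x \<longrightarrow> x \<notin> set p)"
      by (simp add: no_odd_repeated_def)
  qed (simp add: no_odd_repeated_def)
  moreover have "sorted_wrt pod_rel (x # p) \<longleftrightarrow>
      (\<forall>y\<in>set p. y \<le> x) \<and> (odd x \<longrightarrow> x \<notin> set p) \<and> sorted_wrt pod_rel p"
    by (auto simp: pod_rel_def)
  ultimately show ?case
    unfolding Cons.IH sorted_wrt.simps(2) by blast
qed (simp add: no_odd_repeated_def)

text \<open>Positivity of the parts is left to the lower bound: for \<open>c = 0\<close> zero
  entries would be allowed.\<close>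

definition pods_ge :: "nat \<Rightarrow> nat \<Rightarrow> nat list set" where
  "pods_ge c m = {p. sorted_wrt pod_rel p \<and> (\<forall>k\<in>set p. c \<le> k) \<and> sum_list p = m}"

definition pods_even :: "nat \<Rightarrow> nat list set" where
  "pods_even m = {p \<in> pods_ge 1 m. p = [] \<or> even (hd p)}"

definition pods_O2 :: "nat \<Rightarrow> nat list set" where
  "pods_O2 m = {p \<in> pods_ge 1 m. \<exists>x q. p = x # x # q \<and> even x}"

lemma finite_pods_ge: "0 < c \<Longrightarrow> finite (pods_ge c m)"
  by (rule finite_subset[OF _ finite_partitions[of m]])
    (auto simp: pods_ge_def is_partition_def sorted_wrt_pod_rel)

lemma finite_pods_even: "finite (pods_even m)"
  by (simp add: pods_even_def finite_pods_ge)

lemma finite_pods_O2: "finite (pods_O2 m)"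
  by (simp add: pods_O2_def finite_pods_ge)

lemma pod_gt2_eq: "pod_gt2 m = card (pods_ge 3 m)"
proof -
  have "(\<forall>k\<in>set p. 0 < k) \<and> (\<forall>k\<in>set p. 2 < k) \<longleftrightarrow> (\<forall>k\<in>set p. 3 \<le> k)" for p :: "nat list"
    by (induction p) auto
  then show ?thesis
    unfolding pod_gt2_def pods_ge_def is_partition_def sorted_wrt_pod_rel
    by (metis (no_types, lifting))
qed

text \<open>In a non-increasing list all copies of the first entry are adjacent, so a repeated
  largest part already shows in the first two entries.\<close>

lemma O2_eq: "O2 m = card (pods_O2 m)"
proof -
  have "2 \<le> count_list p (hd p) \<longleftrightarrow> (\<exists>x q. p = x # x # q)"
    if "sorted_wrt (\<ge>) p" "p \<noteq> []" for p :: "nat list"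
  proof (cases p rule: remdups_adj.cases)
    case (3 x y q)
    have "x \<in> set (y # q) \<longleftrightarrow> y = x"
      using that(1) 3 by auto
    then show ?thesis
      using 3 by (auto simp: Suc_le_eq count_list_0_iff simp flip: neq0_conv)
  qed (use that in auto)
  then have "{p. is_partition m p \<and> no_odd_repeated p \<and>
      p \<noteq> [] \<and> even (hd p) \<and> 2 \<le> count_list p (hd p)} = pods_O2 m"
    by (fastforce simp: pods_O2_def pods_ge_def is_partition_def sorted_wrt_pod_rel Suc_le_eq)
  then show ?thesis
    by (simp add: O2_def)
qed

lemma card_split_image:
  assumes "A = B \<union> f ` C" "B \<inter> f ` C = {}" "inj_on f C" "finite B" "finite C"
  shows "card A = card B + card C"
  using assms by (simp add: card_Un_disjoint card_image)

section \<open>Recurrences for the numbers of pod partitions\<close>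

text \<open>If \<open>c\<close> is a part, it stands last; delete one copy. Further copies can
  remain only if \<open>c\<close> is even, hence the case distinction in the new bound.\<close>

lemma card_pods_ge_split:
  assumes "0 < c"
  shows "card (pods_ge c (m + c)) =
    card (pods_ge (Suc c) (m + c)) + card (pods_ge (if odd c then Suc c else c) m)"
proof (rule card_split_image[where f = "\<lambda>p. p @ [c]"])
  let ?d = "if odd c then Suc c else c"
  show "pods_ge c (m + c) = pods_ge (Suc c) (m + c) \<union> (\<lambda>p. p @ [c]) ` pods_ge ?d m"
    (is "?L = ?R")
  proof
    show "?L \<subseteq> ?R"
    proof
      fix p assume p: "p \<in> ?L"
      show "p \<in> ?R"
      proof (cases "c \<in> set p")
        case True
        then obtain q y where q: "p = q @ [y]"
          by (cases p rule: rev_cases) auto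
        have "y = c"
          using p True by (auto simp: q pods_ge_def sorted_wrt_append pod_rel_def)
        moreover have "?d \<le> k" if "k \<in> set q" for k
          using p that \<open>y = c\<close>
          by (auto simp: q pods_ge_def sorted_wrt_append pod_rel_def Suc_le_eq le_less)
        ultimately have "q \<in> pods_ge ?d m"
          using p by (simp add: q pods_ge_def sorted_wrt_append)
        then show ?thesis
          using q \<open>y = c\<close> by blast
      next
        case False
        have "Suc c \<le> k" if "k \<in> set p" for k
          using p that False by (auto simp: pods_ge_def Suc_le_eq le_less)
        then show ?thesis
          using p by (simp add: pods_ge_def)
      qed
    qed
    show "?R \<subseteq> ?L"
      by (fastforce simp: pods_ge_def sorted_wrt_append pod_rel_def split: if_splits)
  qed
qed (use assms in \<open>auto simp: inj_on_def finite_pods_ge, auto simp: pods_ge_def\<close>)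

text \<open>The empty partition is treated as having largest part 0. Thus \<open>[]\<close> and
  \<open>[0]\<close> have the same image, and injectivity rests on positive parts.\<close>

fun add_hd :: "nat \<Rightarrow> nat list \<Rightarrow> nat list" where
  "add_hd d [] = [d]"
| "add_hd d (x # p) = (x + d) # p"

lemma inj_on_add_hd: "inj_on (add_hd d) (pods_even m)"
proof (rule inj_onI)
  fix p q assume "p \<in> pods_even m" "q \<in> pods_even m" "add_hd d p = add_hd d q"
  then show "p = q"
    by (cases p; cases q) (auto simp: pods_even_def pods_ge_def)
qed

text \<open>An odd largest part occurs only once, so lowering it by 1 preserves the order and makes
  it even.\<close>

lemma card_pods_even_Suc:
  "card (pods_ge 1 (Suc m)) = card (pods_even (Suc m)) + card (pods_even m)"
proof (rule card_split_image[where f = "add_hd 1"])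
  have "p \<in> add_hd 1 ` pods_even m" if p_in: "p \<in> pods_ge 1 (Suc m)" "p \<notin> pods_even (Suc m)" for p
  proof -
    obtain x q where p: "p = x # q" "odd x"
      using p_in by (cases p) (auto simp: pods_even_def pods_ge_def)
    show ?thesis
    \<comment> \<open>Lowering 1 would leave a zero entry; here the partition is \<open>[1]\<close>
      and its preimage is \<open>[]\<close>.\<close>
    proof (cases "x = 1")
      case True
      have "q = []"
        using that True by (cases q) (auto simp: p pods_ge_def pod_rel_def)
      then show ?thesis
        using that p True by (intro image_eqI[of _ _ "[]"]) (auto simp: pods_even_def pods_ge_def)
    next
      case False
      have "pod_rel (x - 1) k" if "k \<in> set q" for k
        using \<open>p \<in> pods_ge 1 (Suc m)\<close> that p
        by (fastforce simp: pods_ge_def pod_rel_def)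
      then have "(x - 1) # q \<in> pods_even m"
        using that p False by (auto simp: pods_even_def pods_ge_def elim!: oddE)
      then show ?thesis
        using p by (intro image_eqI[of _ _ "(x - 1) # q"]) (auto elim!: oddE)
    qed
  qed
  moreover have "add_hd 1 p \<in> pods_ge 1 (Suc m)" if "p \<in> pods_even m" for p
    using that by (cases p) (auto simp: pods_even_def pods_ge_def pod_rel_def)
  moreover have "pods_even (Suc m) \<subseteq> pods_ge 1 (Suc m)"
    by (auto simp: pods_even_def)
  ultimately show "pods_ge 1 (Suc m) = pods_even (Suc m) \<union> add_hd 1 ` pods_even m"
    by blast
  show "pods_even (Suc m) \<inter> add_hd 1 ` pods_even m = {}"
  proof -
    have "odd (hd (add_hd 1 p)) \<and> add_hd 1 p \<noteq> []" if "p \<in> pods_even m" for p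
      using that by (cases p) (auto simp: pods_even_def)
    then show ?thesis
      by (auto simp: pods_even_def)
  qed
qed (simp_all add: finite_pods_even inj_on_add_hd)

lemma card_pods_even: "card (pods_even m) = card (pods_ge 2 m)"
proof (induction m)
  case 0
  have "pods_ge c 0 = {[]}" if "0 < c" for c
  proof -
    have "p = []" if "p \<in> pods_ge c 0" for p
      using that \<open>0 < c\<close> by (cases p) (auto simp: pods_ge_def)
    then show ?thesis
      by (auto simp: pods_ge_def)
  qed
  moreover have "pods_even 0 = pods_ge 1 0"
    using calculation[of 1] by (auto simp: pods_even_def)
  ultimately show ?case
    by simp
next
  case (Suc m)
  then show ?case
    \<comment> \<open>As 1 is odd, both terms of the split have bound 2, so both sequences obey the
      same recurrence.\<close>
    using card_pods_even_Suc[of m] card_pods_ge_split[of 1 m] by (simp add: numeral_2_eq_2)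
qed

section \<open>Raising the largest part by 2\<close>

text \<open>Lowering the largest part by 2 fails here although it is not repeated: it would fall
  below the second part.\<close>

definition pods_step :: "nat \<Rightarrow> nat list set" where
  "pods_step m = {p \<in> pods_ge 1 m. \<exists>x q. p = Suc x # x # q \<and> odd x}"

lemma card_pods_even_add2:
  "card (pods_even (m + 2)) = card (pods_O2 (m + 2) \<union> pods_step (m + 2)) + card (pods_even m)"
proof (rule card_split_image[where f = "add_hd 2"])
  let ?B = "pods_O2 (m + 2) \<union> pods_step (m + 2)"
  have "p \<in> add_hd 2 ` pods_even m" if p_in: "p \<in> pods_even (m + 2)" "p \<notin> ?B" for p
  proof -
    obtain x q where p: "p = x # q" "even x"
      using p_in by (cases p) (auto simp: pods_even_def pods_ge_def)
    have "2 \<le> x"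
      using that p by (cases "x = 1") (auto simp: pods_even_def pods_ge_def)
    show ?thesis
    proof (cases q)
      case Nil
      show ?thesis
      proof (cases "x = 2")
        case True
        then show ?thesis
          using that p Nil by (intro image_eqI[of _ _ "[]"]) (auto simp: pods_even_def pods_ge_def)
      next
        case False
        then show ?thesis
          using that p Nil \<open>2 \<le> x\<close>
          by (intro image_eqI[of _ _ "[x - 2]"]) (auto simp: pods_even_def pods_ge_def)
      qed
    next
      case (Cons y r)
      have y: "1 \<le> y" "y \<le> x" and r: "\<And>k. k \<in> set r \<Longrightarrow> k \<le> y"
        using that by (auto simp: p Cons pods_even_def pods_ge_def pod_rel_def)
      have "y \<noteq> x"
        using that p Cons by (auto simp: pods_even_def pods_O2_def)
      moreover have "Suc y \<noteq> x"
        using that p Cons by (auto simp: pods_even_def pods_step_def)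
      ultimately have "y \<le> x - 2" "2 < x"
        using y by linarith+
      \<comment> \<open>Equality with \<open>x - 2\<close> is harmless because \<open>x - 2\<close>
        is even.\<close>
      then have "\<forall>k\<in>set q. pod_rel (x - 2) k"
        using p r by (fastforce simp: Cons pod_rel_def)
      then have "(x - 2) # q \<in> pods_even m"
        using that p \<open>2 < x\<close> by (auto simp: pods_even_def pods_ge_def)
      then show ?thesis
        using p \<open>2 < x\<close> by (intro image_eqI[of _ _ "(x - 2) # q"]) auto
    qed
  qed
  moreover have "add_hd 2 p \<in> pods_even (m + 2) - ?B" if "p \<in> pods_even m" for p
    using that by (cases p rule: remdups_adj.cases)
      (auto simp: pods_even_def pods_ge_def pod_rel_def pods_O2_def pods_step_def)
  moreover have "?B \<subseteq> pods_even (m + 2)"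
    by (auto simp: pods_even_def pods_O2_def pods_step_def)
  ultimately show "pods_even (m + 2) = ?B \<union> add_hd 2 ` pods_even m"
    "?B \<inter> add_hd 2 ` pods_even m = {}"
    by blast+
qed (simp_all add: finite_pods_even finite_pods_O2 inj_on_add_hd pods_step_def finite_pods_ge)

text \<open>Sends the top parts 2k - 2, 2k - 2 to 2k, 2k - 1, which raises the sum by 3.\<close>

fun lift_top :: "nat list \<Rightarrow> nat list" where
  "lift_top (x # y # q) = (x + 2) # (y + 1) # q"
| "lift_top p = p"

(* For m = 0 the partition (2, 1) has no preimage. *)
lemma pods_step_eq:
  assumes "0 < m"
  shows "pods_step (m + 3) = lift_top ` pods_O2 m"
proof
  show "lift_top ` pods_O2 m \<subseteq> pods_step (m + 3)"
    by (auto simp: pods_step_def pods_O2_def pods_ge_def pod_rel_def intro!: le_SucI)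
      fastforce
  show "pods_step (m + 3) \<subseteq> lift_top ` pods_O2 m"
  proof
    fix p assume "p \<in> pods_step (m + 3)"
    then obtain x q where p: "p = Suc x # x # q" "odd x" "p \<in> pods_ge 1 (m + 3)"
      by (auto simp: pods_step_def)
    \<comment> \<open>Strict because the odd part \<open>x\<close> is not repeated; hence all of
      \<open>q\<close> stays at most \<open>x - 1\<close> after the lowering.\<close>
    have q: "k < x \<and> 1 \<le> k" if "k \<in> set q" for k
      using that p by (auto simp: pods_ge_def pod_rel_def le_less)
    have "x \<noteq> 1"
    proof
      assume "x = 1"
      then have "q = []"
        using q by (cases q) auto
      then show False
        using p \<open>x = 1\<close> assms by (simp add: pods_ge_def)
    qed
    then obtain z where z: "x = Suc z" "0 < z" "even z"
      using p by (cases x) auto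
    have "z # z # q \<in> pods_O2 m"
      using p q z by (auto simp: pods_O2_def pods_ge_def pod_rel_def less_Suc_eq_le)
    then show "p \<in> lift_top ` pods_O2 m"
      using p z by (intro image_eqI[of _ _ "z # z # q"]) auto
  qed
qed

lemma card_pods_step:
  assumes "0 < m"
  shows "card (pods_step (m + 3)) = card (pods_O2 m)"
  unfolding pods_step_eq[OF assms]
  by (rule card_image) (auto simp: inj_on_def pods_O2_def)

theorem theorem1p5:
  fixes n :: nat
  assumes "n > 4"
  shows "O2 n + O2 (n - 3) = pod_gt2 n"
proof -
  \<comment> \<open>Writing \<open>n - 3\<close> as \<open>k + 1\<close> supplies the positivity
    that \<open>card_pods_step\<close> asks for.\<close>
  obtain k where n: "n = k + 1 + 3"
    using assms that[of "n - 4"] by simp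
  have n2: "n = k + 2 + 2"
    using n by simp
  have "O2 n + O2 (n - 3) = card (pods_O2 n) + card (pods_step n)"
    using card_pods_step[of "k + 1"] by (simp add: O2_eq n)
  also have "\<dots> = card (pods_O2 n \<union> pods_step n)"
    by (rule card_Un_disjoint[symmetric])
      (auto simp: finite_pods_O2 pods_step_def finite_pods_ge pods_O2_def)
  also have "\<dots> + card (pods_even (k + 2)) = card (pods_even n)"
    unfolding n2 by (rule card_pods_even_add2[symmetric])
  finally have "O2 n + O2 (n - 3) + card (pods_even (k + 2)) = card (pods_even n)"
    by simp
  \<comment> \<open>As 2 is even, deleting one 2 keeps the bound 2, and
    \<open>card_pods_even\<close> translates both counts with bound 2.\<close>
  moreover have "card (pods_even n) = pod_gt2 n + card (pods_even (k + 2))"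
    using card_pods_ge_split[of 2 "k + 2"]
    by (simp add: pod_gt2_eq card_pods_even n2 numeral_3_eq_3 numeral_2_eq_2)
  ultimately show ?thesis
    by simp
qed

end
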